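(* Let $(j_{st})_{0\le s\le t}$ be a Lévy process on a real Lie algebra $\mathfrak{g}_{\mathbb{R}}=(\mathfrak{g},* )$ with Schürmann triple $(\rho,\eta,L)$. Then for any hermitian element $Y$ of $\mathfrak{g}_{\mathbb{R}}$ such that $\eta(Y)$ is analytic for $\rho(Y)$, the associated classical Lévy process $(\tilde Y_t)_{t\ge0}$ has characteristic exponent $$\Psi(\lambda)=i\lambda L(Y)+\sum_{n=2}^\infty\frac{(i\lambda)^n}{n!}\big\langle\eta(Y^* ),\rho(Y)^{n-2}\eta(Y)\big\rangle\qquad(\rho(Y)^0=\mathrm{id})$$ for $\lambda$ in some neighborhood of zero; that is, $\mathbb{E}\big(e^{i\lambda\tilde Y_t}\big)=e^{t\Psi(\lambda)}$ for all $t\ge0$ and all such $\lambda$.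
   Context: A real Lie algebra here is a pair $\mathfrak{g}_{\mathbb R}=(\mathfrak{g},* )$ of a complex Lie algebra with an involution. $\mathcal{U}(\mathfrak{g})$ is the universal enveloping $*$-algebra, $\mathcal{U}_0(\mathfrak{g})$ the non-unital subalgebra generated by $\mathfrak{g}$. $\mathcal{L}(D)$ is the $*$-algebra of everywhere defined adjointable operators on a pre-Hilbert space $D$. A Lévy process on $\mathfrak{g}_{\mathbb R}$ over a pre-Hilbert space $K$ with unit vector $\Omega\in K$ is a family $(j_{st}:\mathcal{U}(\mathfrak{g})\to\mathcal{L}(K))_{0\le s\le t}$ of unital $*$-representations such that: (1) $j_{st}(X)+j_{tu}(X)=j_{su}(X)$ for $X\in\mathfrak{g}$, $s\le t\le u$; (2) $[j_{st}(X),j_{s't'}(Y)]=0$ for $s\le t\le s'\le t'$, $X,Y\in\mathfrak{g}$, and $\langle\Omega,j_{s_1t_1}(u_1)\cdots j_{s_nt_n}(u_n)\Omega\rangle=\prod_k\langle\Omega,j_{s_kt_k}(u_k)\Omega\rangle$ for $0\le s_1\le t_1\le s_2\le\cdots\le t_n$, $u_k\in\mathcal{U}(\mathfrak{g})$; (3) $\varphi_{t-s}(u):=\langle\Omega,j_{st}(u)\Omega\rangle$ depends only on $t-s$; (4) $\lim_{t\searrow s}\langle\Omega,j_{st}(u)\Omega\rangle=0$ for $u\in\mathcal{U}_0(\mathfrak{g})$. Its generator is $L(u)=\lim_{t\searrow0}\frac1t\varphi_t(u)$, $u\in\mathcal{U}_0(\mathfrak{g})$. A Schürmann triple on $\mathfrak{g}_{\mathbb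 R}$ is $(\rho,\eta,L)$ with $\rho$ a $*$-representation of $\mathcal{U}_0(\mathfrak{g})$ on a pre-Hilbert space $D$, $\eta:\mathcal{U}_0(\mathfrak{g})\to D$ a surjective linear map with $\eta(uv)=\rho(u)\eta(v)$, and $L$ a hermitian linear functional on $\mathcal{U}_0(\mathfrak{g})$ with $L(uv)=\langle\eta(u^* ),\eta(v)\rangle$. The Schürmann triple of a Lévy process is the one (unique up to unitary equivalence) whose functional $L$ is the generator. The process is (up to equality of all joint vacuum moments) realized on the symmetric Fock space $\Gamma(L^2(\mathbb{R}_+,D))$ by $j_{st}(X)=\Lambda_{st}(\rho(X))+A^*_{st}(\eta(X))+A_{st}(\eta(X^* ))+(t-s)L(X)\mathrm{id}$, $X\in\mathfrak{g}$, with $\Omega$ the vacuum. For hermitian $Y=Y^*\in\mathfrak{g}$, the operators $j_{st}(Y)$ commute and are hermitian; the associated classical Lévy process $(\tilde Y_t)_{t\ge0}$ is a classical (real-valued) Lévy process with moments $\mathbb{E}(\tilde Y_{t_1}\cdots\tilde Y_{t_n})=\langle\Omega,j_{0t_1}(Y)\cdots j_{0t_n}(Y)\Omega\rangle$ for all $t_1,\ldots,t_n\ge0$. A vector $v\in D$ is analytic for $\rho(Y)$ if $\sum_n\frac{|\lambda|^n}{n!}\|\rho(Y)^nv\|<\infty$ for all sufficiently small $|\lambda|$. *)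

theory Defs
  imports "HOL-Probability.Probability" "HOL-Library.Poly_Mapping"
begin

section \<open>Complex vector spaces, involutions, pre-Hilbert spaces\<close>

class complex_vector = ab_group_add +
  fixes scaleC :: "complex \<Rightarrow> 'a \<Rightarrow> 'a"  (infixr \<open>*\<^sub>C\<close> 75)
  assumes scaleC_add_right: "a *\<^sub>C (x + y) = a *\<^sub>C x + a *\<^sub>C y"
    and scaleC_add_left: "(a + b) *\<^sub>C x = a *\<^sub>C x + b *\<^sub>C x"
    and scaleC_scaleC: "a *\<^sub>C b *\<^sub>C x = (a * b) *\<^sub>C x"
    and scaleC_one: "1 *\<^sub>C x = x"

instantiation complex :: complex_vector
begin
definition scaleC_complex_def: "scaleC (a::complex) (x::complex) = a * x"
instance by standard (simp_all add: scaleC_complex_def algebra_simps)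
end

class star_vector = complex_vector +
  fixes star :: "'a \<Rightarrow> 'a"
  assumes star_add: "star (x + y) = star x + star y"
    and star_scaleC: "star (a *\<^sub>C x) = cnj a *\<^sub>C star x"
    and star_star: "star (star x) = x"

class star_algebra_1 = ring_1 + star_vector +
  assumes scaleC_mult_left: "(a *\<^sub>C x) * y = a *\<^sub>C (x * y)"
    and scaleC_mult_right: "x * (a *\<^sub>C y) = a *\<^sub>C (x * y)"
    and star_mult: "star (x * y) = star y * star x"

class complex_pre_hilbert = complex_vector +
  fixes cinner :: "'a \<Rightarrow> 'a \<Rightarrow> complex"
  assumes cinner_add_right: "cinner x (y + z) = cinner x y + cinner x z"
    and cinner_scaleC_right: "cinner x (a *\<^sub>C y) = a * cinner x y"
    and cinner_commute: "cinner y x = cnj (cinner x y)"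
    and cinner_pos: "x \<noteq> 0 \<Longrightarrow> 0 < Re (cinner x x)"

definition cnorm :: "'a::complex_pre_hilbert \<Rightarrow> real" where
  "cnorm x = sqrt (Re (cinner x x))"

definition clinear_on :: "'a::complex_vector set \<Rightarrow> ('a \<Rightarrow> 'b::complex_vector) \<Rightarrow> bool" where
  "clinear_on S f \<longleftrightarrow>
     (\<forall>x\<in>S. \<forall>y\<in>S. f (x + y) = f x + f y) \<and> (\<forall>a. \<forall>x\<in>S. f (a *\<^sub>C x) = a *\<^sub>C f x)"

definition is_adjoint :: "('a::complex_pre_hilbert \<Rightarrow> 'a) \<Rightarrow> ('a \<Rightarrow> 'a) \<Rightarrow> bool" where
  "is_adjoint A B \<longleftrightarrow> (\<forall>x y. cinner (A x) y = cinner x (B y))"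

text \<open>The everywhere defined adjointable operators form the underlying set of the \<open>*\<close>-algebra
  \<open>\<L>(D)\<close>.\<close>

definition adjointable_ops :: "('a::complex_pre_hilbert \<Rightarrow> 'a) set" where
  "adjointable_ops =
     {A. clinear_on UNIV A \<and> (\<exists>B. clinear_on UNIV B \<and> is_adjoint A B)}"


section \<open>Real Lie algebras\<close>

text \<open>A real Lie algebra is encoded as a complex Lie algebra together with a conjugate-linear
  involution that reverses the bracket.\<close>

class real_lie_algebra = star_vector +
  fixes bracket :: "'a \<Rightarrow> 'a \<Rightarrow> 'a"
  assumes bracket_add_left: "bracket (x + y) z = bracket x z + bracket y z"
    and bracket_add_right: "bracket x (y + z) = bracket x y + bracket x z"
    and bracket_scaleC_left: "bracket (a *\<^sub>C x) y = a *\<^sub>C bracket x y"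
    and bracket_scaleC_right: "bracket x (a *\<^sub>C y) = a *\<^sub>C bracket x y"
    and bracket_self: "bracket x x = 0"
    and jacobi: "bracket x (bracket y z) + bracket y (bracket z x) + bracket z (bracket x y) = 0"
    and star_bracket: "star (bracket x y) = bracket (star y) (star x)"


section \<open>The universal enveloping \<open>*\<close>-algebra\<close>

text \<open>Words are a copy of lists, so that concatenation can be the monoid operation underlying
  the convolution product of \<^typ>\<open>'m \<Rightarrow>\<^sub>0 complex\<close>.\<close>

datatype 'a word = Word (letters: "'a list")

instantiation word :: (type) monoid_add
begin
definition zero_word_def: "0 = Word []"
definition plus_word_def: "v + w = Word (letters v @ letters w)"
instance by standard (simp_all add: zero_word_def plus_word_def)
end

type_synonym 'a free_alg = "'a word \<Rightarrow>\<^sub>0 complex"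

definition free_gen :: "'a \<Rightarrow> 'a free_alg" where
  "free_gen x = Poly_Mapping.single (Word [x]) 1"

definition free_const :: "complex \<Rightarrow> 'a free_alg" where
  "free_const c = Poly_Mapping.single 0 c"

text \<open>The letters of the free algebra are all vectors of the Lie algebra. The first two kinds of
  relations turn it into the tensor algebra, the third into the universal enveloping algebra.\<close>

inductive_set uea_ideal :: "'g::real_lie_algebra free_alg set" where
  add_rel: "free_gen (x + y) - (free_gen x + free_gen y) \<in> uea_ideal"
| scale_rel: "free_gen (c *\<^sub>C x) - free_const c * free_gen x \<in> uea_ideal"
| bracket_rel: "free_gen x * free_gen y - free_gen y * free_gen x - free_gen (bracket x y) \<in> uea_ideal"
| zero: "0 \<in> uea_ideal"
| add: "p \<in> uea_ideal \<Longrightarrow> q \<in> uea_ideal \<Longrightarrow> p + q \<in> uea_ideal"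
| mult_left: "p \<in> uea_ideal \<Longrightarrow> q * p \<in> uea_ideal"
| mult_right: "p \<in> uea_ideal \<Longrightarrow> p * q \<in> uea_ideal"

definition word_star :: "'g::star_vector word \<Rightarrow> 'g word" where
  "word_star w = Word (rev (map star (letters w)))"

lemma word_star_word_star [simp]: "word_star (word_star w) = w"
  by (simp add: word_star_def rev_map o_def star_star)

lemma word_star_add: "word_star (v + w) = word_star w + word_star v"
  by (simp add: word_star_def plus_word_def)

lemma word_star_zero [simp]: "word_star 0 = 0"
  by (simp add: word_star_def zero_word_def)

lift_definition free_star :: "'g::star_vector free_alg \<Rightarrow> 'g free_alg"
  is "\<lambda>f w. cnj (f (word_star w))"
proof -
  fix f :: "'g word \<Rightarrow> complex"
  assume "finite {w. f w \<noteq> 0}"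
  then have "finite (word_star ` {w. f w \<noteq> 0})" by simp
  moreover have "{w. cnj (f (word_star w)) \<noteq> 0} \<subseteq> word_star ` {w. f w \<noteq> 0}"
    by (auto intro!: image_eqI[where x = "word_star _"])
  ultimately show "finite {w. cnj (f (word_star w)) \<noteq> 0}"
    by (rule rev_finite_subset)
qed

lemma free_star_add: "free_star (p + q) = free_star p + free_star q"
  by transfer (simp add: fun_eq_iff)

lemma free_star_diff: "free_star (p - q) = free_star p - free_star q"
  by transfer (simp add: fun_eq_iff)

lemma free_star_zero [simp]: "free_star 0 = 0"
  by transfer (simp add: fun_eq_iff)

lemma free_star_free_star [simp]: "free_star (free_star p) = p"
  by transfer (simp add: fun_eq_iff)

lemma free_star_single:
  "free_star (Poly_Mapping.single w c) = Poly_Mapping.single (word_star w) (cnj c)"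
  by transfer (auto simp: fun_eq_iff when_def)

lemma free_alg_induct [case_names single add]:
  fixes p :: "'a free_alg"
  assumes "\<And>w c. P (Poly_Mapping.single w c)" and "\<And>p q. P p \<Longrightarrow> P q \<Longrightarrow> P (p + q)"
  shows "P p"
proof (induction p rule: update_induct)
  case const
  show ?case using assms(1)[of undefined 0] by simp
next
  case (update f a b)
  have "Poly_Mapping.update a b f = f + Poly_Mapping.single a b"
    using update.hyps(1)
    by (intro poly_mapping_eqI)
      (auto simp: lookup_update lookup_add lookup_single when_def in_keys_iff)
  then show ?case using update.IH assms by simp
qed

lemma free_star_mult: "free_star (p * q) = free_star q * free_star p"
proof (induction p rule: free_alg_induct)
  case (single w c)
  show ?case
    by (induction q rule: free_alg_induct)
      (simp_all add: mult_single free_star_single free_star_add word_star_add algebra_simps)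
next
  case (add p p')
  then show ?case by (simp add: free_star_add algebra_simps)
qed

lemma free_star_gen: "free_star (free_gen x) = free_gen (star x)"
  by (simp add: free_gen_def free_star_single word_star_def)

lemma free_star_const: "free_star (free_const c) = free_const (cnj c)"
  by (simp add: free_const_def free_star_single)

lemma free_const_comm: "free_const c * p = p * free_const c"
  by (induction p rule: free_alg_induct)
    (simp_all add: free_const_def mult_single algebra_simps)

lemma free_const_mult: "free_const (a * b) = free_const a * free_const b"
  by (simp add: free_const_def mult_single)

lemma free_const_add: "free_const (a + b) = free_const a + free_const b"
  by (simp add: free_const_def single_add)

lemma free_const_one: "free_const 1 = 1"
  by (simp add: free_const_def single_one)

lemma uea_ideal_uminus: "p \<in> uea_ideal \<Longrightarrow> - p \<in> uea_ideal"
  using uea_ideal.mult_left[of p "- 1"] by simp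

lemma uea_ideal_diff: "p \<in> uea_ideal \<Longrightarrow> q \<in> uea_ideal \<Longrightarrow> p - q \<in> uea_ideal"
  using uea_ideal.add[of p "- q"] uea_ideal_uminus[of q] by simp

lemma uea_ideal_star: "p \<in> uea_ideal \<Longrightarrow> free_star p \<in> uea_ideal"
proof (induction rule: uea_ideal.induct)
  case (add_rel x y)
  then show ?case
    using uea_ideal.add_rel[of "star x" "star y"]
    by (simp add: free_star_diff free_star_add free_star_gen star_add)
next
  case (scale_rel c x)
  then show ?case
    using uea_ideal.scale_rel[of "cnj c" "star x"]
    by (simp add: free_star_diff free_star_mult free_star_gen free_star_const star_scaleC
        free_const_comm)
next
  case (bracket_rel x y)
  then show ?case
    using uea_ideal.bracket_rel[of "star y" "star x"]
    by (simp add: free_star_diff free_star_mult free_star_gen star_bracket)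
qed (simp_all add: free_star_add free_star_mult uea_ideal.intros)

lemma lookup_zero_mult:
  fixes p q :: "'a free_alg"
  shows "Poly_Mapping.lookup (p * q) 0 = Poly_Mapping.lookup p 0 * Poly_Mapping.lookup q 0"
proof (induction p rule: free_alg_induct)
  case (single w c)
  have *: "v + w = 0 \<longleftrightarrow> v = 0 \<and> w = 0" for v w :: "'a word"
    by (cases v; cases w) (auto simp: zero_word_def plus_word_def)
  show ?case
    by (induction q rule: free_alg_induct)
      (auto simp: mult_single lookup_single lookup_add algebra_simps when_def *)
next
  case (add p p')
  then show ?case by (simp add: lookup_add algebra_simps)
qed

lemma uea_ideal_lookup_zero:
  fixes p :: "'g::real_lie_algebra free_alg"
  shows "p \<in> uea_ideal \<Longrightarrow> Poly_Mapping.lookup p 0 = 0"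
proof -
  have [simp]: "Poly_Mapping.lookup (free_gen x) 0 = 0" for x :: 'g
    by (simp add: free_gen_def lookup_single when_def zero_word_def)
  show "p \<in> uea_ideal \<Longrightarrow> Poly_Mapping.lookup p 0 = 0"
    by (induction rule: uea_ideal.induct) (simp_all add: lookup_minus lookup_add lookup_zero_mult)
qed

definition uea_rel :: "'g::real_lie_algebra free_alg \<Rightarrow> 'g free_alg \<Rightarrow> bool" where
  "uea_rel p q \<longleftrightarrow> p - q \<in> uea_ideal"

quotient_type (overloaded) 'g uea = "'g::real_lie_algebra free_alg" / uea_rel
proof (rule equivpI)
  show "reflp uea_rel"
    by (simp add: reflp_def uea_rel_def uea_ideal.zero)
  show "symp uea_rel"
    unfolding symp_def uea_rel_def using uea_ideal_uminus by fastforce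
  show "transp uea_rel"
  proof (rule transpI)
    fix p q r
    assume "uea_rel p q" "uea_rel q r"
    then have "(p - q) + (q - r) \<in> uea_ideal"
      unfolding uea_rel_def by (rule uea_ideal.add)
    then show "uea_rel p r" by (simp add: uea_rel_def)
  qed
qed

instantiation uea :: (real_lie_algebra) star_algebra_1
begin

lift_definition zero_uea :: "'a uea" is 0 .
lift_definition one_uea :: "'a uea" is 1 .

lift_definition plus_uea :: "'a uea \<Rightarrow> 'a uea \<Rightarrow> 'a uea" is "(+)"
proof -
  fix p p' q q' :: "'a free_alg"
  assume "uea_rel p p'" "uea_rel q q'"
  then have "(p - p') + (q - q') \<in> uea_ideal"
    unfolding uea_rel_def by (rule uea_ideal.add)
  then show "uea_rel (p + q) (p' + q')" by (simp add: uea_rel_def algebra_simps)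
qed

lift_definition minus_uea :: "'a uea \<Rightarrow> 'a uea \<Rightarrow> 'a uea" is "(-)"
proof -
  fix p p' q q' :: "'a free_alg"
  assume "uea_rel p p'" "uea_rel q q'"
  then have "(p - p') - (q - q') \<in> uea_ideal"
    unfolding uea_rel_def by (rule uea_ideal_diff)
  then show "uea_rel (p - q) (p' - q')" by (simp add: uea_rel_def algebra_simps)
qed

lift_definition uminus_uea :: "'a uea \<Rightarrow> 'a uea" is uminus
proof -
  fix p p' :: "'a free_alg"
  assume "uea_rel p p'"
  then have "- (p - p') \<in> uea_ideal"
    unfolding uea_rel_def by (rule uea_ideal_uminus)
  then show "uea_rel (- p) (- p')" by (simp add: uea_rel_def algebra_simps)
qed

lift_definition times_uea :: "'a uea \<Rightarrow> 'a uea \<Rightarrow> 'a uea" is "(*)"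
proof -
  fix p p' q q' :: "'a free_alg"
  assume "uea_rel p p'" "uea_rel q q'"
  then have "(p - p') * q + p' * (q - q') \<in> uea_ideal"
    unfolding uea_rel_def by (intro uea_ideal.add uea_ideal.mult_left uea_ideal.mult_right)
  then show "uea_rel (p * q) (p' * q')" by (simp add: uea_rel_def algebra_simps)
qed

lift_definition scaleC_uea :: "complex \<Rightarrow> 'a uea \<Rightarrow> 'a uea" is "\<lambda>c p. free_const c * p"
proof -
  fix c and p p' :: "'a free_alg"
  assume "uea_rel p p'"
  then have "free_const c * (p - p') \<in> uea_ideal"
    unfolding uea_rel_def by (rule uea_ideal.mult_left)
  then show "uea_rel (free_const c * p) (free_const c * p')"
    by (simp add: uea_rel_def algebra_simps)
qed

lift_definition star_uea :: "'a uea \<Rightarrow> 'a uea" is free_star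
proof -
  fix p p' :: "'a free_alg"
  assume "uea_rel p p'"
  then have "free_star (p - p') \<in> uea_ideal"
    unfolding uea_rel_def by (rule uea_ideal_star)
  then show "uea_rel (free_star p) (free_star p')"
    by (simp add: uea_rel_def free_star_diff)
qed

lemma uea_rel_refl: "p = q \<Longrightarrow> uea_rel p q"
  by (simp add: uea_rel_def uea_ideal.zero)

instance
proof
  fix x y z :: "'a uea" and a b :: complex
  show "x + y + z = x + (y + z)" by transfer (rule uea_rel_refl, simp add: algebra_simps)
  show "x + y = y + x" by transfer (rule uea_rel_refl, simp add: algebra_simps)
  show "0 + x = x" by transfer (rule uea_rel_refl, simp)
  show "- x + x = 0" by transfer (rule uea_rel_refl, simp)
  show "x - y = x + - y" by transfer (rule uea_rel_refl, simp)
  show "x * y * z = x * (y * z)" by transfer (rule uea_rel_refl, simp add: algebra_simps)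
  show "(x + y) * z = x * z + y * z" by transfer (rule uea_rel_refl, simp add: algebra_simps)
  show "x * (y + z) = x * y + x * z" by transfer (rule uea_rel_refl, simp add: algebra_simps)
  show "1 * x = x" by transfer (rule uea_rel_refl, simp)
  show "x * 1 = x" by transfer (rule uea_rel_refl, simp)
  show "(0::'a uea) \<noteq> 1"
    by transfer (auto simp: uea_rel_def lookup_minus lookup_one dest: uea_ideal_lookup_zero)
  show "a *\<^sub>C (x + y) = a *\<^sub>C x + a *\<^sub>C y"
    by transfer (rule uea_rel_refl, simp add: algebra_simps)
  show "(a + b) *\<^sub>C x = a *\<^sub>C x + b *\<^sub>C x"
    by transfer (rule uea_rel_refl, simp add: free_const_add algebra_simps)
  show "a *\<^sub>C b *\<^sub>C x = (a * b) *\<^sub>C x"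
    by transfer (rule uea_rel_refl, simp add: free_const_mult mult.assoc)
  show "1 *\<^sub>C x = x"
    by transfer (rule uea_rel_refl, simp add: free_const_one)
  show "star (x + y) = star x + star y"
    by transfer (rule uea_rel_refl, simp add: free_star_add)
  show "star (a *\<^sub>C x) = cnj a *\<^sub>C star x"
    by transfer (rule uea_rel_refl, simp add: free_star_mult free_star_const free_const_comm)
  show "star (star x) = x"
    by transfer (rule uea_rel_refl, simp)
  show "(a *\<^sub>C x) * y = a *\<^sub>C (x * y)"
    by transfer (rule uea_rel_refl, simp add: mult.assoc)
  show "x * (a *\<^sub>C y) = a *\<^sub>C (x * y)"
    by transfer (rule uea_rel_refl, metis free_const_comm mult.assoc)
  show "star (x * y) = star y * star x"
    by transfer (rule uea_rel_refl, simp add: free_star_mult)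
qed

end

lift_definition uea_of :: "'g::real_lie_algebra \<Rightarrow> 'g uea" is free_gen .

lemma clinear_uea_of: "clinear_on UNIV (uea_of :: 'g::real_lie_algebra \<Rightarrow> 'g uea)"
proof -
  have "uea_of (x + y) = uea_of x + uea_of y" for x y :: 'g
    by transfer (simp add: uea_rel_def uea_ideal.add_rel)
  moreover have "uea_of (c *\<^sub>C x) = c *\<^sub>C uea_of x" for c and x :: 'g
    by transfer (simp add: uea_rel_def uea_ideal.scale_rel)
  ultimately show ?thesis by (simp add: clinear_on_def)
qed

lemma uea_of_bracket: "uea_of (bracket x y) = uea_of x * uea_of y - uea_of y * uea_of x"
proof transfer
  fix x y :: 'a
  show "uea_rel (free_gen (bracket x y)) (free_gen x * free_gen y - free_gen y * free_gen x)"
    using uea_ideal_uminus[OF uea_ideal.bracket_rel[of x y]] by (simp add: uea_rel_def algebra_simps)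
qed

lemma star_uea_of: "star (uea_of x) = uea_of (star x)"
  by transfer (simp add: uea_rel_def uea_ideal.zero free_star_gen)

text \<open>The non-unital subalgebra generated by the Lie algebra.\<close>

inductive_set uea0 :: "'g::real_lie_algebra uea set" where
  of: "uea_of x \<in> uea0"
| add: "u \<in> uea0 \<Longrightarrow> v \<in> uea0 \<Longrightarrow> u + v \<in> uea0"
| scaleC: "u \<in> uea0 \<Longrightarrow> c *\<^sub>C u \<in> uea0"
| mult: "u \<in> uea0 \<Longrightarrow> v \<in> uea0 \<Longrightarrow> u * v \<in> uea0"

lemma star_uea0: "u \<in> uea0 \<Longrightarrow> star u \<in> uea0"
  by (induction rule: uea0.induct)
    (simp_all add: star_uea_of star_add star_scaleC star_mult uea0.intros)


section \<open>Representations, Levy processes and Schuermann triples\<close>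

text \<open>Maps on \<^const>\<open>uea0\<close> are represented by functions on the whole algebra, whose values outside
  \<^const>\<open>uea0\<close> are irrelevant.\<close>

definition star_rep_on ::
    "'u::star_algebra_1 set \<Rightarrow> ('u \<Rightarrow> 'd::complex_pre_hilbert \<Rightarrow> 'd) \<Rightarrow> bool" where
  "star_rep_on S \<pi> \<longleftrightarrow>
     (\<forall>u\<in>S. \<pi> u \<in> adjointable_ops) \<and>
     (\<forall>x. clinear_on S (\<lambda>u. \<pi> u x)) \<and>
     (\<forall>u\<in>S. \<forall>v\<in>S. \<pi> (u * v) = \<pi> u \<circ> \<pi> v) \<and>
     (\<forall>u\<in>S. is_adjoint (\<pi> u) (\<pi> (star u)))"

definition levy_process ::
    "(real \<Rightarrow> real \<Rightarrow> 'g::real_lie_algebra uea \<Rightarrow> 'k::complex_pre_hilbert \<Rightarrow> 'k) \<Rightarrow> 'k \<Rightarrow> bool" where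
  "levy_process j \<Omega> \<longleftrightarrow>
     cinner \<Omega> \<Omega> = 1 \<and>
     (\<forall>s t. 0 \<le> s \<and> s \<le> t \<longrightarrow> star_rep_on UNIV (j s t) \<and> j s t 1 = id) \<and>
     (\<forall>s t u X. 0 \<le> s \<and> s \<le> t \<and> t \<le> u \<longrightarrow>
        (\<forall>x. j s t (uea_of X) x + j t u (uea_of X) x = j s u (uea_of X) x)) \<and>
     (\<forall>s t s' t' X Y. 0 \<le> s \<and> s \<le> t \<and> t \<le> s' \<and> s' \<le> t' \<longrightarrow>
        j s t (uea_of X) \<circ> j s' t' (uea_of Y) = j s' t' (uea_of Y) \<circ> j s t (uea_of X)) \<and>
     (\<forall>(n::nat) (s::nat \<Rightarrow> real) (t::nat \<Rightarrow> real) (u::nat \<Rightarrow> 'g uea).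
        (\<forall>k<n. 0 \<le> s k \<and> s k \<le> t k) \<and> (\<forall>k. Suc k < n \<longrightarrow> t k \<le> s (Suc k)) \<longrightarrow>
        cinner \<Omega> (foldr (\<lambda>k. j (s k) (t k) (u k)) [0..<n] \<Omega>) =
        (\<Prod>k<n. cinner \<Omega> (j (s k) (t k) (u k) \<Omega>))) \<and>
     (\<forall>s t s' t' u. 0 \<le> s \<and> s \<le> t \<and> 0 \<le> s' \<and> s' \<le> t' \<and> t - s = t' - s' \<longrightarrow>
        cinner \<Omega> (j s t u \<Omega>) = cinner \<Omega> (j s' t' u \<Omega>)) \<and>
     (\<forall>s u. 0 \<le> s \<and> u \<in> uea0 \<longrightarrow>
        ((\<lambda>t. cinner \<Omega> (j s t u \<Omega>)) \<longlongrightarrow> 0) (at_right s))"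

text \<open>Only the values of \<open>L\<close> on \<^const>\<open>uea0\<close> matter; by stationarity \<open>\<phi>\<^sub>t\<close> is the vacuum state at
  \<open>j\<^sub>0\<^sub>t\<close>.\<close>

definition is_generator ::
    "(real \<Rightarrow> real \<Rightarrow> 'g::real_lie_algebra uea \<Rightarrow> 'k::complex_pre_hilbert \<Rightarrow> 'k) \<Rightarrow> 'k
      \<Rightarrow> ('g uea \<Rightarrow> complex) \<Rightarrow> bool" where
  "is_generator j \<Omega> L \<longleftrightarrow>
     (\<forall>u\<in>uea0. ((\<lambda>t. cinner \<Omega> (j 0 t u \<Omega>) / complex_of_real t) \<longlongrightarrow> L u) (at_right 0))"

definition schurmann_triple ::
    "('g::real_lie_algebra uea \<Rightarrow> 'd::complex_pre_hilbert \<Rightarrow> 'd) \<Rightarrow> ('g uea \<Rightarrow> 'd)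
      \<Rightarrow> ('g uea \<Rightarrow> complex) \<Rightarrow> bool" where
  "schurmann_triple \<rho> \<eta> L \<longleftrightarrow>
     star_rep_on uea0 \<rho> \<and>
     clinear_on uea0 \<eta> \<and> \<eta> ` uea0 = UNIV \<and>
     (\<forall>u\<in>uea0. \<forall>v\<in>uea0. \<eta> (u * v) = \<rho> u (\<eta> v)) \<and>
     clinear_on uea0 L \<and> (\<forall>u\<in>uea0. L (star u) = cnj (L u)) \<and>
     (\<forall>u\<in>uea0. \<forall>v\<in>uea0. L (u * v) = cinner (\<eta> (star u)) (\<eta> v))"

definition schurmann_triple_of ::
    "(real \<Rightarrow> real \<Rightarrow> 'g::real_lie_algebra uea \<Rightarrow> 'k::complex_pre_hilbert \<Rightarrow> 'k) \<Rightarrow> 'k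
      \<Rightarrow> ('g uea \<Rightarrow> 'd::complex_pre_hilbert \<Rightarrow> 'd) \<Rightarrow> ('g uea \<Rightarrow> 'd) \<Rightarrow> ('g uea \<Rightarrow> complex) \<Rightarrow> bool" where
  "schurmann_triple_of j \<Omega> \<rho> \<eta> L \<longleftrightarrow> schurmann_triple \<rho> \<eta> L \<and> is_generator j \<Omega> L"

definition analytic_vector :: "('d::complex_pre_hilbert \<Rightarrow> 'd) \<Rightarrow> 'd \<Rightarrow> bool" where
  "analytic_vector A v \<longleftrightarrow>
     (\<exists>\<epsilon>>0. \<forall>l::complex. norm l < \<epsilon> \<longrightarrow>
        summable (\<lambda>n. norm l ^ n / fact n * cnorm ((A ^^ n) v)))"


section \<open>Classical Levy processes\<close>

text \<open>Stationary independent increments, start at zero and continuity in probability; no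
  regularity of the paths is demanded.\<close>

definition classical_levy_process :: "'w measure \<Rightarrow> (real \<Rightarrow> 'w \<Rightarrow> real) \<Rightarrow> bool" where
  "classical_levy_process M X \<longleftrightarrow>
     prob_space M \<and>
     (\<forall>t\<ge>0. X t \<in> borel_measurable M) \<and>
     (AE \<omega> in M. X 0 \<omega> = 0) \<and>
     (\<forall>(n::nat) (t::nat \<Rightarrow> real). 0 \<le> t 0 \<and> (\<forall>k<n. t k \<le> t (Suc k)) \<longrightarrow>
        prob_space.indep_vars M (\<lambda>_. borel) (\<lambda>k \<omega>. X (t (Suc k)) \<omega> - X (t k) \<omega>) {..<n}) \<and>
     (\<forall>s t. 0 \<le> s \<and> s \<le> t \<longrightarrow>
        distr M borel (\<lambda>\<omega>. X t \<omega> - X s \<omega>) = distr M borel (X (t - s))) \<and>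
     (\<forall>t\<ge>0. \<forall>\<epsilon>>0.
        ((\<lambda>s. measure M {\<omega> \<in> space M. \<bar>X s \<omega> - X t \<omega>\<bar> > \<epsilon>}) \<longlongrightarrow> 0) (at t within {0..}))"

text \<open>Equality of all joint moments includes that the classical moments exist: the Bochner
  integral of a function that is not integrable would silently be zero.\<close>

definition associated_classical_levy_process ::
    "(real \<Rightarrow> real \<Rightarrow> 'g::real_lie_algebra uea \<Rightarrow> 'k::complex_pre_hilbert \<Rightarrow> 'k) \<Rightarrow> 'k \<Rightarrow> 'g
      \<Rightarrow> 'w measure \<Rightarrow> (real \<Rightarrow> 'w \<Rightarrow> real) \<Rightarrow> bool" where
  "associated_classical_levy_process j \<Omega> Y M X \<longleftrightarrow>
     classical_levy_process M X \<and>
     (\<forall>ts. (\<forall>t\<in>set ts. 0 \<le> t) \<longrightarrow>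
        integrable M (\<lambda>\<omega>. \<Prod>t\<leftarrow>ts. X t \<omega>) \<and>
        complex_of_real (LINT \<omega>|M. (\<Prod>t\<leftarrow>ts. X t \<omega>)) =
          cinner \<Omega> (foldr (\<lambda>t. j 0 t (uea_of Y)) ts \<Omega>))"

end

theory Submission
  imports Defs "HOL-Complex_Analysis.Complex_Analysis" "HOL-Real_Asymp.Real_Asymp"
begin

text \<open>The exponential generating series \<open>F\<^sub>t\<close> of the moments of \<open>X\<^sub>t\<close>, taken as a formal
  power series, satisfies \<open>F\<^sub>s\<^sub>+\<^sub>t = F\<^sub>s F\<^sub>t\<close> by independence and stationarity of the increments, and
  the definition of the generator identifies the derivatives at \<open>t = 0\<close> of its coefficients with
  those of \<open>C = \<Sum>\<^sub>n\<^sub>\<ge>\<^sub>1 L(Y\<^sup>n) x\<^sup>n / n!\<close>. A semigroup of formal power series with constant term 1 is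
  determined by these derivatives, so \<open>F\<^sub>t = exp (t C)\<close> formally.
  The Schuermann triple relations give \<open>L(Y\<^sup>n) = \<langle>\<eta>(Y\<^sup>*), \<rho>(Y)\<^sup>n\<^sup>-\<^sup>2 \<eta>(Y)\<rangle>\<close> for \<open>n \<ge> 2\<close>; by Cauchy--Schwarz
  and analyticity \<open>C\<close> converges in a disc, and there \<open>exp (t C)\<close> is holomorphic, so
  \<open>F\<^sub>t\<close> converges in the same disc for every \<open>t\<close>. Convergence of the even part makes \<open>cosh (\<lambda> X\<^sub>t)\<close>
  integrable, and dominated convergence then sums the characteristic function from the moments.\<close>

section \<open>The Cauchy--Schwarz inequality\<close>

lemma scaleC_zero_left: "0 *\<^sub>C (x::'a::complex_vector) = 0"
  using scaleC_add_left[of 0 0 x] by simp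

lemma cinner_zero_right: "cinner (x::'a::complex_pre_hilbert) 0 = 0"
  using cinner_scaleC_right[of x 0 0] by (simp add: scaleC_zero_left)

lemma cinner_self: "cinner (x::'a::complex_pre_hilbert) x = of_real ((cnorm x)\<^sup>2)"
proof -
  have "Im (cinner x x) = 0"
    using arg_cong[OF cinner_commute[of x x], of Im] by simp
  moreover have "0 \<le> Re (cinner x x)"
    using cinner_pos[of x] cinner_zero_right[of x] by (cases "x = 0") auto
  ultimately show ?thesis
    by (simp add: cnorm_def complex_eq_iff)
qed

lemma cnorm_nonneg: "0 \<le> cnorm x"
proof -
  have "0 \<le> Re (cinner x x)"
    using cinner_pos[of x] cinner_zero_right[of x] by (cases "x = 0") auto
  then show ?thesis
    by (simp add: cnorm_def)
qed

lemma cinner_add_scaleC_self: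
  fixes x y :: "'a::complex_pre_hilbert"
  shows "Re (cinner (x + a *\<^sub>C y) (x + a *\<^sub>C y)) =
    (cnorm x)\<^sup>2 + 2 * Re (a * cinner x y) + (norm a)\<^sup>2 * (cnorm y)\<^sup>2"
proof -
  have 1: "cinner (x + a *\<^sub>C y) z = cinner x z + cnj a * cinner y z" for z
    by (metis cinner_add_right cinner_commute cinner_scaleC_right complex_cnj_add
        complex_cnj_mult)
  have 2: "cinner y x = cnj (cinner x y)"
    by (rule cinner_commute)
  have "cinner (x + a *\<^sub>C y) (x + a *\<^sub>C y) =
      of_real ((cnorm x)\<^sup>2) + a * cinner x y + cnj (a * cinner x y)
      + (a * cnj a) * of_real ((cnorm y)\<^sup>2)"
    by (simp only: 1 cinner_add_right cinner_scaleC_right cinner_self[of x] cinner_self[of y] 2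
        complex_cnj_mult algebra_simps)
  also have "a * cnj a = of_real ((norm a)\<^sup>2)"
    by (rule complex_norm_square[symmetric])
  finally show ?thesis
    by simp
qed

lemma norm_cinner_le:
  fixes x y :: "'a::complex_pre_hilbert"
  shows "norm (cinner x y) \<le> cnorm x * cnorm y"
proof (cases "y = 0")
  case True
  then show ?thesis
    by (simp add: cinner_zero_right cnorm_nonneg)
next
  case False
  define b where "b = (cnorm y)\<^sup>2"
  have b: "0 < b"
    using cinner_pos[OF False] by (simp add: b_def cinner_self)
  define w where "w = cinner x y"
  \<comment> \<open>This scalar minimises the norm of \<open>x + a *\<^sub>C y\<close>, which it
    makes orthogonal to \<open>y\<close>.\<close>
  define a where "a = - cnj w / of_real b"
  have "0 \<le> (cnorm (x + a *\<^sub>C y))\<^sup>2"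
    by simp
  also have "(cnorm (x + a *\<^sub>C y))\<^sup>2 = Re (cinner (x + a *\<^sub>C y) (x + a *\<^sub>C y))"
    by (simp add: cinner_self)
  also have "\<dots> = (cnorm x)\<^sup>2 + 2 * Re (a * w) + (norm a)\<^sup>2 * b"
    by (simp add: cinner_add_scaleC_self w_def b_def)
  also have "a * w = of_real (- ((norm w)\<^sup>2 / b))"
    using complex_norm_square[of w] by (simp add: a_def mult.commute)
  also have "(norm a)\<^sup>2 * b = (norm w)\<^sup>2 / b"
    using b by (simp add: a_def norm_divide power_divide power2_eq_square)
  finally have "(norm w)\<^sup>2 \<le> (cnorm x)\<^sup>2 * b"
    using b by (simp add: field_simps)
  then have "(norm w)\<^sup>2 \<le> (cnorm x * cnorm y)\<^sup>2"
    by (simp add: b_def power_mult_distrib)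
  then show ?thesis
    unfolding w_def by (rule power2_le_imp_le) (simp add: cnorm_nonneg)
qed

section \<open>Semigroups of formal power series\<close>

text \<open>Additivity makes \<open>d h / h\<close> constant along \<open>h = t / (n + 1)\<close>.
  These points tend to 0 from the right, so the constant is the limit 0.\<close>

lemma additive_zero_if_derivative_zero:
  fixes d :: "real \<Rightarrow> 'a::real_normed_field"
  assumes add: "\<And>s t. 0 \<le> s \<Longrightarrow> 0 \<le> t \<Longrightarrow> d (s + t) = d s + d t"
    and lim: "((\<lambda>h. d h / of_real h) \<longlongrightarrow> 0) (at_right 0)"
    and t: "0 \<le> t"
  shows "d t = 0"
proof (cases "t = 0")
  case True
  then show ?thesis
    using add[of 0 0] by simp
next
  case False
  with t have t: "0 < t"
    by simp
  have mult: "d (of_nat n * h) = of_nat n * d h" if "0 \<le> h" for n h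
    using that add[of 0 0]
    by (induction n) (simp_all add: algebra_simps add)
  have "d (t / real (Suc n)) / of_real (t / real (Suc n)) = d t / of_real t" for n
    using mult[of "t / real (Suc n)" "Suc n"] t
    by (simp add: field_simps del: of_nat_Suc)
  moreover have "filterlim (\<lambda>n. t / real (Suc n)) (at_right 0) sequentially"
    using t by real_asymp
  ultimately have "(\<lambda>n. d t / of_real t) \<longlonglongrightarrow> 0"
    using filterlim_compose[OF lim] by fastforce
  then show ?thesis
    using t by (simp add: LIMSEQ_const_iff)
qed

text \<open>For \<open>n > 0\<close> the coefficient is a polynomial in \<open>h\<close> without
  constant term, because \<open>C ^ 0 = 1\<close>. Dividing by \<open>h\<close> and letting
  \<open>h\<close> tend to 0 leaves its linear coefficient, which comes from
  \<open>C ^ 1\<close>.\<close>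

lemma fps_exp_compose_derivative:
  fixes C :: "'a::real_normed_field fps"
  assumes "fps_nth C 0 = 0" "n > 0"
  shows "((\<lambda>h. fps_nth (fps_exp (of_real h) oo C) n / of_real h) \<longlongrightarrow> fps_nth C n) (at_right 0)"
proof -
  have eq: "fps_nth (fps_exp (of_real h) oo C) n / of_real h =
      (\<Sum>i=1..n. of_real h ^ (i - 1) / fact i * fps_nth (C ^ i) n)" if "h > 0" for h :: real
  proof -
    have "fps_nth (fps_exp (of_real h) oo C) n / of_real h =
        (\<Sum>i=0..n. of_real h ^ i / fact i * fps_nth (C ^ i) n / of_real h)"
      by (simp add: fps_compose_nth sum_divide_distrib)
    also have "\<dots> = (\<Sum>i=1..n. of_real h ^ i / fact i * fps_nth (C ^ i) n / of_real h)"
      using \<open>n > 0\<close> by (intro sum.mono_neutral_right) (auto simp: not_less_eq_eq)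
    also have "\<dots> = (\<Sum>i=1..n. of_real h ^ (i - 1) / fact i * fps_nth (C ^ i) n)"
      using that by (intro sum.cong) (auto simp: power_eq_if)
    finally show ?thesis .
  qed
  have "((\<lambda>h::real. \<Sum>i=1..n. of_real h ^ (i - 1) / fact i * fps_nth (C ^ i) n) \<longlongrightarrow>
      (\<Sum>i=1..n. of_real 0 ^ (i - 1) / fact i * fps_nth (C ^ i) n)) (at_right 0)"
    by (intro tendsto_intros) auto
  also have "(\<Sum>i=1..n. of_real 0 ^ (i - 1) / fact i * fps_nth (C ^ i) n) =
      (\<Sum>i\<in>{1}. of_real 0 ^ (i - 1) / fact i * fps_nth (C ^ i) n)"
    using assms by (intro sum.mono_neutral_right) (auto simp: power_0_left)
  finally show ?thesis
    using eq by (auto elim!: Lim_transform_eventually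
        simp: eventually_at_right_less eventually_mono[OF eventually_at_right_less])
qed

text \<open>The series \<open>exp (t C)\<close> form a second semigroup with constant coefficient 1
  and the same derivatives at 0. The two are compared coefficient by coefficient, by strong
  induction for all times at once.\<close>

lemma fps_convolution_semigroup_eq_exp:
  fixes F :: "real \<Rightarrow> 'a::real_normed_field fps"
  assumes semigroup: "\<And>s t. 0 \<le> s \<Longrightarrow> 0 \<le> t \<Longrightarrow> F (s + t) = F s * F t"
    and F0: "\<And>t. 0 \<le> t \<Longrightarrow> fps_nth (F t) 0 = 1"
    and generator: "\<And>n. 0 < n \<Longrightarrow>
      ((\<lambda>h. fps_nth (F h) n / of_real h) \<longlongrightarrow> fps_nth C n) (at_right 0)"
    and C0: "fps_nth C 0 = 0"
    and t: "0 \<le> t"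
  shows "F t = fps_exp (of_real t) oo C"
proof (rule fps_ext)
  define Q where "Q t = fps_exp (of_real t :: 'a) oo C" for t
  have Q_add: "Q (s + t) = Q s * Q t" for s t
    by (simp add: Q_def fps_exp_add_mult fps_compose_mult_distrib[OF C0])
  have Q0: "fps_nth (Q t) 0 = 1" for t
    by (simp add: Q_def)
  fix n
  have "fps_nth (F t) n - fps_nth (Q t) n = 0"
    using t
  proof (induction n arbitrary: t rule: less_induct)
    case (less n)
    show ?case
    proof (cases "n = 0")
      case True
      then show ?thesis
        using less.prems by (simp add: F0 Q0)
    next
      case False
      \<comment> \<open>Only the two end terms of the Cauchy product contain an \<open>n\<close>-th
        coefficient. The others have lower indices in both factors, where the induction hypothesis
        applies at times \<open>s\<close> and \<open>t\<close>.\<close>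
      have split: "fps_nth (f * g) n =
          fps_nth f n + fps_nth g n + (\<Sum>i=1..<n. fps_nth f i * fps_nth g (n - i))"
        if "fps_nth f 0 = 1" "fps_nth g 0 = 1" for f g :: "'a fps"
      proof -
        have "{0..n} = insert 0 (insert n {1..<n})"
          by auto
        then show ?thesis
          using that False by (simp add: fps_mult_nth)
      qed
      \<comment> \<open>Once the lower coefficients agree, the defect in the \<open>n\<close>-th one is additive in time.\<close>
      show ?thesis
      proof (rule additive_zero_if_derivative_zero[OF _ _ less.prems])
        fix s t :: real
        assume st: "0 \<le> s" "0 \<le> t"
        have "(\<Sum>i=1..<n. fps_nth (F s) i * fps_nth (F t) (n - i)) =
            (\<Sum>i=1..<n. fps_nth (Q s) i * fps_nth (Q t) (n - i))"
          using less.IH st by (intro sum.cong) auto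
        then show "fps_nth (F (s + t)) n - fps_nth (Q (s + t)) n =
            fps_nth (F s) n - fps_nth (Q s) n + (fps_nth (F t) n - fps_nth (Q t) n)"
          using st by (simp add: semigroup Q_add split F0 Q0)
      next
        show "((\<lambda>h. (fps_nth (F h) n - fps_nth (Q h) n) / of_real h) \<longlongrightarrow> 0) (at_right 0)"
          using tendsto_diff[OF generator fps_exp_compose_derivative[OF C0], of n n] False
          by (simp add: Q_def diff_divide_distrib)
      qed
    qed
  qed
  then show "fps_nth (F t) n = fps_nth (fps_exp (of_real t) oo C) n"
    by (simp add: Q_def)
qed

text \<open>The radius of convergence does not depend on \<open>a\<close> because \<open>exp (a C)\<close> is holomorphic wherever
  \<open>C\<close> converges.\<close>

lemma fps_exp_compose_sums:
  fixes C :: "complex fps"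
  assumes C0: "fps_nth C 0 = 0" and R: "0 < R" "R \<le> fps_conv_radius C" and z: "ereal (norm z) < R"
  shows "(\<lambda>n. fps_nth (fps_exp a oo C) n * z ^ n) sums exp (a * eval_fps C z)"
proof -
  have "((\<lambda>z. exp (a * z)) \<circ> eval_fps C) has_fps_expansion (fps_exp a oo C)"
    using R C0
    by (intro has_fps_expansion_compose has_fps_expansion_exp eval_fps_has_fps_expansion) auto
  moreover have "((\<lambda>z. exp (a * z)) \<circ> eval_fps C) holomorphic_on eball 0 R"
    using R unfolding o_def by (intro holomorphic_intros) (auto intro: less_le_trans)
  ultimately show ?thesis
    using has_fps_expansion_imp_sums_complex[of "(\<lambda>z. exp (a * z)) \<circ> eval_fps C", OF _ _ z]
    by (simp only: o_def)
qed

section \<open>Characteristic functions and moments\<close>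

text \<open>Exchanging series and integral calls for a dominating function, but \<open>conv\<close>
  controls moments, not absolute moments. For even exponents the two coincide, and the even terms
  alone make \<open>cosh (l * Z x)\<close> integrable; twice this function bounds every partial sum
  of the exponential series.\<close>

lemma (in prob_space) char_exp_sums_moments:
  fixes Z :: "'a \<Rightarrow> real"
  assumes int: "\<And>n. integrable M (\<lambda>x. Z x ^ n)"
    and conv: "summable (\<lambda>n. norm l ^ n / fact n * \<bar>LINT x|M. Z x ^ n\<bar>)"
  shows "(\<lambda>n. (\<i> * of_real l) ^ n / fact n * of_real (LINT x|M. Z x ^ n)) sums
    (LINT x|M. exp (\<i> * of_real l * of_real (Z x)))"
proof -
  have Z [measurable]: "Z \<in> borel_measurable M"
    using borel_measurable_integrable[OF int[of 1]] by simp
  define f where "f n x = (if even n then (l * Z x) ^ n /\<^sub>R fact n else 0)" for n x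
  have f_sums: "(\<lambda>n. f n x) sums cosh (l * Z x)" for x
    unfolding f_def by (rule cosh_converges)
  have f_nonneg: "0 \<le> f n x" for n x
    by (simp add: f_def zero_le_even_power)
  have f_int: "integrable M (f n)" for n
    using int[of n] unfolding f_def by (cases "even n") (simp_all add: power_mult_distrib)
  have "integrable M (\<lambda>x. suminf (\<lambda>n. f n x))"
  proof (rule integrable_suminf)
    show "AE x in M. summable (\<lambda>n. norm (f n x))"
      using f_sums by (auto simp: f_nonneg intro: sums_summable)
    have "norm (LINT x|M. norm (f n x)) \<le> norm l ^ n / fact n * \<bar>LINT x|M. Z x ^ n\<bar>" for n
    proof (cases "even n")
      case True
      then have "(LINT x|M. norm (f n x)) = l ^ n / fact n * (LINT x|M. Z x ^ n)"
        unfolding real_norm_def abs_of_nonneg[OF f_nonneg]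
        by (simp add: f_def power_mult_distrib divide_inverse mult.commute mult.left_commute)
      then show ?thesis
        by (simp add: abs_mult power_abs)
    qed (simp add: f_def)
    then show "summable (\<lambda>n. LINT x|M. norm (f n x))"
      by (intro summable_comparison_test'[OF conv])
  qed (rule f_int)
  then have cosh_int: "integrable M (\<lambda>x. cosh (l * Z x))"
    using f_sums by (simp add: sums_iff)
  have exp_le: "exp \<bar>y\<bar> \<le> 2 * cosh y" for y :: real
    by (cases "0 \<le> y") (simp_all add: cosh_def)
  have partial_le: "norm (\<Sum>n<N. (\<i> * of_real l * of_real y) ^ n / fact n) \<le> 2 * cosh (l * y)"
    for N and y :: real
  proof -
    have "norm (\<Sum>n<N. (\<i> * of_real l * of_real y) ^ n / fact n) \<le>
        (\<Sum>n<N. \<bar>l * y\<bar> ^ n /\<^sub>R fact n)"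
      by (rule order.trans[OF norm_sum])
        (simp add: norm_divide norm_mult norm_power abs_mult divide_inverse norm_inverse
          mult.commute)
    also have "\<dots> \<le> exp \<bar>l * y\<bar>"
      using sum_le_suminf[OF sums_summable[OF exp_converges[of "\<bar>l * y\<bar>"]], of "{..<N}"]
      by (simp add: exp_def)
    finally show ?thesis
      using exp_le[of "l * y"] by simp
  qed
  have "(\<lambda>N. LINT x|M. (\<Sum>n<N. (\<i> * of_real l * of_real (Z x)) ^ n / fact n)) \<longlonglongrightarrow>
      (LINT x|M. exp (\<i> * of_real l * of_real (Z x)))"
  proof (rule integral_dominated_convergence[where w = "\<lambda>x. 2 * cosh (l * Z x)"])
    show "integrable M (\<lambda>x. 2 * cosh (l * Z x))"
      using cosh_int by simp
    show "AE x in M. (\<lambda>N. \<Sum>n<N. (\<i> * of_real l * of_real (Z x)) ^ n / fact n) \<longlonglongrightarrow>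
        exp (\<i> * of_real l * of_real (Z x))"
      using exp_converges[of "\<i> * of_real l * of_real (Z x)" for x]
      by (simp add: sums_def scaleR_conv_of_real divide_inverse mult.commute)
  qed (use partial_le in auto)
  moreover have "(LINT x|M. (\<Sum>n<N. (\<i> * of_real l * of_real (Z x)) ^ n / fact n)) =
      (\<Sum>n<N. (\<i> * of_real l) ^ n / fact n * of_real (LINT x|M. Z x ^ n))" for N
  proof -
    have eq: "(\<i> * of_real l * of_real (Z x)) ^ n / fact n =
        (\<i> * of_real l) ^ n / fact n * complex_of_real (Z x ^ n)" for n x
      by (simp add: power_mult_distrib)
    have "integrable M (\<lambda>x. complex_of_real (Z x ^ n))" for n
      using int[of n] by (rule integrable_of_real)
    then show ?thesis
      unfolding eq
      by (subst Bochner_Integration.integral_sum)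
        (auto simp del: of_real_power intro!: sum.cong)
  qed
  ultimately show ?thesis
    by (simp add: sums_def)
qed


text \<open>Almost surely \<open>X (s + t)\<close> is the sum of two independent increments
  distributed as \<open>X s\<close> and \<open>X t\<close>. The binomial theorem expands the power,
  and independence factors each expectation.\<close>

lemma classical_levy_process_moment_add:
  fixes X :: "real \<Rightarrow> 'w \<Rightarrow> real"
  assumes X: "classical_levy_process M X"
    and int: "\<And>t n. 0 \<le> t \<Longrightarrow> integrable M (\<lambda>\<omega>. X t \<omega> ^ n)"
    and st: "0 \<le> s" "0 \<le> t"
  shows "(LINT \<omega>|M. X (s + t) \<omega> ^ n) =
    (\<Sum>i\<le>n. of_nat (n choose i) * (LINT \<omega>|M. X s \<omega> ^ i) * (LINT \<omega>|M. X t \<omega> ^ (n - i)))"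
proof -
  interpret prob_space M
    using X by (simp add: classical_levy_process_def)
  have meas: "X u \<in> borel_measurable M" if "0 \<le> u" for u
    using X that by (simp add: classical_levy_process_def)
  have [measurable]: "X s \<in> borel_measurable M" "X t \<in> borel_measurable M"
    "X (s + t) \<in> borel_measurable M" "X 0 \<in> borel_measurable M"
    using st by (auto intro: meas)
  have X0: "AE \<omega> in M. X 0 \<omega> = 0"
    using X by (simp add: classical_levy_process_def)
  \<comment> \<open>Independence is given for increments, so \<open>X 0\<close> is subtracted
    although it vanishes almost surely.\<close>
  define A where "A \<omega> = X s \<omega> - X 0 \<omega>" for \<omega>
  define B where "B \<omega> = X (s + t) \<omega> - X s \<omega>" for \<omega>
  have [measurable]: "A \<in> borel_measurable M" "B \<in> borel_measurable M"
    unfolding A_def B_def by measurable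
  have A_eq: "AE \<omega> in M. A \<omega> = X s \<omega>"
    using X0 by eventually_elim (simp add: A_def)
  have A_int: "integrable M (\<lambda>\<omega>. A \<omega> ^ i)"
    and A_moment: "(LINT \<omega>|M. A \<omega> ^ i) = (LINT \<omega>|M. X s \<omega> ^ i)" for i
  proof -
    have ae: "AE \<omega> in M. A \<omega> ^ i = X s \<omega> ^ i"
      using A_eq by eventually_elim simp
    show "integrable M (\<lambda>\<omega>. A \<omega> ^ i)"
      using integrable_cong_AE[OF _ _ ae] int[OF st(1)] by simp
    show "(LINT \<omega>|M. A \<omega> ^ i) = (LINT \<omega>|M. X s \<omega> ^ i)"
      using ae by (intro integral_cong_AE) auto
  qed
  have "distr M borel B = distr M borel (X (s + t - s))"
    using X st unfolding B_def classical_levy_process_def by fastforce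
  then have distr: "distr M borel B = distr M borel (X t)"
    by simp
  have B_int: "integrable M (\<lambda>\<omega>. B \<omega> ^ i)"
    and B_moment: "(LINT \<omega>|M. B \<omega> ^ i) = (LINT \<omega>|M. X t \<omega> ^ i)" for i
  proof -
    have "integrable (distr M borel (X t)) (\<lambda>x. x ^ i)"
      using int[OF st(2), of i] by (subst integrable_distr_eq) auto
    then have "integrable (distr M borel B) (\<lambda>x. x ^ i)"
      by (simp add: distr)
    then show "integrable M (\<lambda>\<omega>. B \<omega> ^ i)"
      by (subst (asm) integrable_distr_eq) auto
    have "(LINT \<omega>|M. B \<omega> ^ i) = (LINT x|distr M borel B. x ^ i)"
      by (subst integral_distr) auto
    also have "\<dots> = (LINT \<omega>|M. X t \<omega> ^ i)"
      unfolding distr by (subst integral_distr) auto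
    finally show "(LINT \<omega>|M. B \<omega> ^ i) = (LINT \<omega>|M. X t \<omega> ^ i)" .
  qed
  \<comment> \<open>The time grid \<open>0, s, s + t\<close>, whose two increments are
    \<open>A\<close> and \<open>B\<close>.\<close>
  define r where "r k = (if k = 0 then 0 else if k = 1 then s else s + t)" for k :: nat
  have r: "0 \<le> r 0 \<and> (\<forall>k<2. r k \<le> r (Suc k))"
    using st by (auto simp: r_def)
  have "indep_vars (\<lambda>_. borel) (\<lambda>k \<omega>. X (r (Suc k)) \<omega> - X (r k) \<omega>) {..<2::nat}"
    using X r unfolding classical_levy_process_def by blast
  then have "indep_vars (\<lambda>_. borel) (\<lambda>k \<omega>. X (r (Suc k)) \<omega> - X (r k) \<omega>) (insert 0 {1})"
    by (rule indep_vars_subset) auto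
  \<comment> \<open>The sum over the singleton \<open>{1}\<close> turns independence of the family
    into independence of the pair \<open>A\<close>, \<open>B\<close>.\<close>
  from indep_vars_sum[OF _ _ this] have indep: "indep_var borel A borel B"
    by (simp add: r_def A_def[abs_def] B_def[abs_def])
  have indep_pow: "indep_var borel (\<lambda>\<omega>. A \<omega> ^ i) borel (\<lambda>\<omega>. B \<omega> ^ k)" for i k
    using indep_var_compose[OF indep, of "\<lambda>x. x ^ i" borel "\<lambda>x. x ^ k" borel]
    by (simp add: o_def)
  have "(LINT \<omega>|M. X (s + t) \<omega> ^ n) = (LINT \<omega>|M. (A \<omega> + B \<omega>) ^ n)"
    using X0 by (intro integral_cong_AE) (auto simp: A_def B_def)
  also have "\<dots> = (LINT \<omega>|M. (\<Sum>i\<le>n. of_nat (n choose i) * (A \<omega> ^ i * B \<omega> ^ (n - i))))"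
    by (simp add: binomial_ring mult.assoc)
  also have "\<dots> = (\<Sum>i\<le>n. of_nat (n choose i) * (LINT \<omega>|M. A \<omega> ^ i * B \<omega> ^ (n - i)))"
    by (simp add: Bochner_Integration.integral_sum indep_var_integrable[OF indep_pow A_int B_int])
  also have "\<dots> = (\<Sum>i\<le>n. of_nat (n choose i) *
      ((LINT \<omega>|M. X s \<omega> ^ i) * (LINT \<omega>|M. X t \<omega> ^ (n - i))))"
    by (simp add: indep_var_lebesgue_integral[OF indep_pow A_int B_int] A_moment B_moment)
  finally show ?thesis
    by (simp add: mult.assoc)
qed

section \<open>Powers of a Lie algebra element\<close>

lemma star_rep_on_power:
  assumes "star_rep_on UNIV \<pi>" "\<pi> 1 = id"
  shows "\<pi> (u ^ n) = \<pi> u ^^ n"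
  using assms by (induction n) (auto simp: star_rep_on_def)

lemma uea0_power_Suc: "u \<in> uea0 \<Longrightarrow> u ^ Suc n \<in> uea0"
  by (induction n) (auto intro: uea0.mult)

lemma schurmann_triple_cocycle_power:
  assumes "schurmann_triple \<rho> \<eta> L" "u \<in> uea0"
  shows "\<eta> (u ^ Suc n) = (\<rho> u ^^ n) (\<eta> u)"
proof (induction n)
  case (Suc n)
  have "\<eta> (u * u ^ Suc n) = \<rho> u (\<eta> (u ^ Suc n))"
    using assms uea0_power_Suc[OF assms(2)] by (auto simp: schurmann_triple_def)
  then show ?case
    using Suc.IH by simp
qed simp

text \<open>Both factors of \<open>u * u ^ Suc n\<close> lie in \<open>uea0\<close>, so the product
  rule for \<open>L\<close> applies. A product of two such factors has exponent at least 2, whence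
  the shift.\<close>

lemma schurmann_triple_functional_power:
  assumes "schurmann_triple \<rho> \<eta> L" "u \<in> uea0"
  shows "L (u ^ (n + 2)) = cinner (\<eta> (star u)) ((\<rho> u ^^ n) (\<eta> u))"
proof -
  have "L (u * u ^ Suc n) = cinner (\<eta> (star u)) (\<eta> (u ^ Suc n))"
    using assms uea0_power_Suc[OF assms(2)] by (auto simp: schurmann_triple_def)
  then show ?thesis
    unfolding schurmann_triple_cocycle_power[OF assms] by simp
qed

text \<open>A joint moment at \<open>n\<close> equal times is an iterate of
  \<open>j 0 t (uea_of Y)\<close>. Multiplicativity of the representation turns it into a power
  inside the algebra, the form to which the generator applies.\<close>

lemma associated_process_moment:
  assumes j: "levy_process j \<Omega>" and X: "associated_classical_levy_process j \<Omega> Y M X"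
    and t: "0 \<le> t"
  shows "integrable M (\<lambda>\<omega>. X t \<omega> ^ n)"
    and "complex_of_real (LINT \<omega>|M. X t \<omega> ^ n) = cinner \<Omega> (j 0 t (uea_of Y ^ n) \<Omega>)"
proof -
  have "star_rep_on UNIV (j 0 t)" "j 0 t 1 = id"
    using j t unfolding levy_process_def by auto
  moreover have "foldr (\<lambda>t. j 0 t (uea_of Y)) (replicate n t) \<Omega> = (j 0 t (uea_of Y) ^^ n) \<Omega>"
    by (induction n) simp_all
  moreover have "integrable M (\<lambda>\<omega>. \<Prod>t\<leftarrow>replicate n t. X t \<omega>) \<and>
        complex_of_real (LINT \<omega>|M. (\<Prod>t\<leftarrow>replicate n t. X t \<omega>)) =
          cinner \<Omega> (foldr (\<lambda>t. j 0 t (uea_of Y)) (replicate n t) \<Omega>)"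
    using X t unfolding associated_classical_levy_process_def by (metis in_set_replicate)
  ultimately show "integrable M (\<lambda>\<omega>. X t \<omega> ^ n)"
    and "complex_of_real (LINT \<omega>|M. X t \<omega> ^ n) = cinner \<Omega> (j 0 t (uea_of Y ^ n) \<Omega>)"
    by (simp_all add: star_rep_on_power)
qed

text \<open>Summability is asserted explicitly because \<open>suminf\<close> alone does not express
  convergence. One \<epsilon> serves all times. The truncated subtraction \<open>n - 2\<close> is
  harmless, as \<open>c\<close> is evaluated only at \<open>n + 2\<close>.\<close>

theorem theorem4p4p3:
  fixes j :: "real \<Rightarrow> real \<Rightarrow> 'g::real_lie_algebra uea \<Rightarrow> 'k::complex_pre_hilbert \<Rightarrow> 'k"
    and \<Omega> :: 'k
    and \<rho> :: "'g uea \<Rightarrow> 'd::complex_pre_hilbert \<Rightarrow> 'd"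
    and \<eta> :: "'g uea \<Rightarrow> 'd"
    and L :: "'g uea \<Rightarrow> complex"
    and Y :: 'g
    and M :: "'w measure"
    and X :: "real \<Rightarrow> 'w \<Rightarrow> real"
  assumes "levy_process j \<Omega>"
    and "schurmann_triple_of j \<Omega> \<rho> \<eta> L"
    and "star Y = Y"
    and "analytic_vector (\<rho> (uea_of Y)) (\<eta> (uea_of Y))"
    and "associated_classical_levy_process j \<Omega> Y M X"
  shows "\<exists>\<epsilon>>0. \<forall>l::real. \<bar>l\<bar> < \<epsilon> \<longrightarrow>
    (let c = \<lambda>n::nat. (\<i> * of_real l) ^ n / fact n *
               cinner (\<eta> (uea_of (star Y))) (((\<rho> (uea_of Y)) ^^ (n - 2)) (\<eta> (uea_of Y)));
         \<Psi> = \<i> * of_real l * L (uea_of Y) + suminf (\<lambda>n. c (n + 2))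
     in summable (\<lambda>n. c (n + 2)) \<and>
        (\<forall>t\<ge>0. (LINT \<omega>|M. exp (\<i> * of_real l * of_real (X t \<omega>))) = exp (of_real t * \<Psi>)))"
proof -
  let ?u = "uea_of Y"
  have triple: "schurmann_triple \<rho> \<eta> L" and generator: "is_generator j \<Omega> L"
    using assms(2) by (simp_all add: schurmann_triple_of_def)
  have process: "classical_levy_process M X"
    using assms(5) by (simp add: associated_classical_levy_process_def)
  interpret prob_space M
    using process by (simp add: classical_levy_process_def)
  note int = associated_process_moment(1)[OF assms(1) assms(5)]
  note moment = associated_process_moment(2)[OF assms(1) assms(5)]
  \<comment> \<open>\<open>C\<close> is the cumulant series per unit time. Its constant coefficient
    is set to 0, since \<open>L\<close> carries no information about \<open>?u ^ 0 = 1\<close> and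
    composition with \<open>fps_exp\<close> wants a zero constant term.\<close>
  define C where "C = Abs_fps (\<lambda>n. if n = 0 then 0 else L (?u ^ n) / fact n)"
  define F where "F t = Abs_fps (\<lambda>n. complex_of_real (LINT \<omega>|M. X t \<omega> ^ n) / fact n)" for t
  have C0: "fps_nth C 0 = 0"
    by (simp add: C_def)
  have C1: "fps_nth C 1 = L ?u"
    by (simp add: C_def)
  have C2: "fps_nth C (n + 2) =
      cinner (\<eta> (uea_of (star Y))) ((\<rho> ?u ^^ n) (\<eta> ?u)) / fact (n + 2)" for n
    using schurmann_triple_functional_power[OF triple uea0.of, of Y n]
    by (simp add: C_def star_uea_of)
  have F_eq: "F t = fps_exp (of_real t) oo C" if "0 \<le> t" for t
  proof (rule fps_convolution_semigroup_eq_exp[OF _ _ _ C0 that])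
    fix s t :: real
    assume st: "0 \<le> s" "0 \<le> t"
    show "F (s + t) = F s * F t"
    proof (rule fps_ext)
      fix n
      let ?m = "\<lambda>t n. complex_of_real (LINT \<omega>|M. X t \<omega> ^ n)"
      have "?m (s + t) n = (\<Sum>i\<le>n. of_nat (n choose i) * ?m s i * ?m t (n - i))"
        by (subst classical_levy_process_moment_add[OF process int st]) simp_all
      then have "?m (s + t) n / fact n =
          (\<Sum>i\<le>n. of_nat (n choose i) * ?m s i * ?m t (n - i) / fact n)"
        by (simp add: sum_divide_distrib)
      \<comment> \<open>The factorials absorb the binomial coefficients, so the binomial convolution
        of moments becomes a Cauchy product.\<close>
      also have "\<dots> = (\<Sum>i\<le>n. (?m s i / fact i) * (?m t (n - i) / fact (n - i)))"
        by (intro sum.cong) (simp_all add: binomial_fact)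
      finally show "fps_nth (F (s + t)) n = fps_nth (F s * F t) n"
        by (simp add: F_def fps_mult_nth atMost_atLeast0)
    qed
  next
    fix n :: nat
    assume n: "0 < n"
    then have "?u ^ n \<in> uea0"
      using uea0_power_Suc[OF uea0.of[of Y], of "n - 1"] by simp
    then have "((\<lambda>h. cinner \<Omega> (j 0 h (?u ^ n) \<Omega>) / of_real h / fact n) \<longlongrightarrow> L (?u ^ n) / fact n)
        (at_right 0)"
      using generator by (intro tendsto_intros) (auto simp: is_generator_def)
    moreover have "\<forall>\<^sub>F h in at_right 0.
        cinner \<Omega> (j 0 h (?u ^ n) \<Omega>) / of_real h / fact n = fps_nth (F h) n / of_real h"
      using eventually_at_right_less[of "0::real"]
      by eventually_elim (simp add: F_def moment)
    ultimately show "((\<lambda>h. fps_nth (F h) n / of_real h) \<longlongrightarrow> fps_nth C n) (at_right 0)"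
      using n by (auto simp: C_def intro: Lim_transform_eventually)
  qed (simp add: F_def prob_space)

  \<comment> \<open>The radius from the analyticity of \<open>\<eta> (uea_of Y)\<close> is the
    neighbourhood of the conclusion.\<close>
  obtain \<epsilon> where \<epsilon>: "0 < \<epsilon>" and analytic:
    "\<And>l::complex. norm l < \<epsilon> \<Longrightarrow> summable (\<lambda>n. norm l ^ n / fact n * cnorm ((\<rho> ?u ^^ n) (\<eta> ?u)))"
    using assms(4) unfolding analytic_vector_def by blast
  have C_summable: "summable (\<lambda>n. fps_nth C n * z ^ n)" if z: "norm z < \<epsilon>" for z
  proof -
    let ?k = "cnorm (\<eta> (uea_of (star Y)))"
    let ?a = "\<lambda>n. norm z ^ n / fact n * cnorm ((\<rho> ?u ^^ n) (\<eta> ?u))"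
    \<comment> \<open>Cauchy--Schwarz together with \<open>fact n \<le> fact (n + 2)\<close>
      compares the tail of \<open>C\<close> with the analyticity series.\<close>
    have "norm (fps_nth C (n + 2) * z ^ (n + 2)) \<le> norm z ^ 2 * ?k * ?a n" for n
    proof -
      have "norm (fps_nth C (n + 2) * z ^ (n + 2)) =
          norm (cinner (\<eta> (uea_of (star Y))) ((\<rho> ?u ^^ n) (\<eta> ?u))) / fact (n + 2)
          * norm z ^ (n + 2)"
        unfolding C2 by (simp only: norm_mult norm_divide norm_power norm_fact)
      also have "\<dots> \<le> ?k * cnorm ((\<rho> ?u ^^ n) (\<eta> ?u)) / fact n * norm z ^ (n + 2)"
        by (intro mult_right_mono frac_le norm_cinner_le fact_mono) (auto simp: cnorm_nonneg)
      also have "\<dots> = norm z ^ 2 * ?k * ?a n"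
        by (simp add: power_add power2_eq_square mult_ac)
      finally show ?thesis .
    qed
    then have "summable (\<lambda>n. fps_nth C (n + 2) * z ^ (n + 2))"
      by (rule summable_comparison_test'[OF summable_mult[OF analytic[OF z]]])
    then show ?thesis
      by (simp only: summable_iff_shift[of "\<lambda>n. fps_nth C n * z ^ n"])
  qed
  have radius: "ereal \<epsilon> \<le> fps_conv_radius C"
    unfolding fps_conv_radius_def by (rule conv_radius_geI_ex') (simp add: C_summable)

  show ?thesis
  proof (intro exI conjI allI impI)
    show "0 < \<epsilon>"
      by fact
  next
    fix l :: real
    assume l: "\<bar>l\<bar> < \<epsilon>"
    define z where "z = \<i> * of_real l"
    have z: "norm z < \<epsilon>"
      using l by (simp add: z_def norm_mult)
    define c where "c n = z ^ n / fact n *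
      cinner (\<eta> (uea_of (star Y))) ((\<rho> ?u ^^ (n - 2)) (\<eta> ?u))" for n :: nat
    have c: "c (n + 2) = fps_nth C (n + 2) * z ^ (n + 2)" for n
      unfolding C2 c_def by simp
    have c_summable: "summable (\<lambda>n. c (n + 2))"
      unfolding c by (rule summable_ignore_initial_segment[OF C_summable[OF z]])
    \<comment> \<open>The two terms split off are the zero constant term and the drift
      \<open>z * L ?u\<close>.\<close>
    have "eval_fps C z = suminf (\<lambda>n. fps_nth C (n + 2) * z ^ (n + 2)) + (\<Sum>n<2. fps_nth C n * z ^ n)"
      unfolding eval_fps_def by (rule suminf_split_initial_segment[OF C_summable[OF z]])
    then have \<Psi>: "eval_fps C z = z * L ?u + suminf (\<lambda>n. c (n + 2))"
      unfolding c using C0 C1 by (simp add: numeral_2_eq_2)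
    have char: "(LINT \<omega>|M. exp (z * of_real (X t \<omega>))) =
        exp (of_real t * (z * L ?u + suminf (\<lambda>n. c (n + 2))))" if t: "0 \<le> t" for t
    proof -
      have sums: "(\<lambda>n. fps_nth (F t) n * w ^ n) sums exp (of_real t * eval_fps C w)"
        if "norm w < \<epsilon>" for w
        unfolding F_eq[OF t] using \<epsilon> that by (intro fps_exp_compose_sums[OF C0 _ radius]) auto
      \<comment> \<open>Convergence in the whole disc, not only at \<open>z\<close>, yields absolute
        convergence at \<open>l\<close>, as \<open>char_exp_sums_moments\<close> demands.\<close>
      have radius_F: "ereal \<epsilon> \<le> fps_conv_radius (F t)"
        unfolding fps_conv_radius_def
        by (rule conv_radius_geI_ex') (simp add: sums_summable[OF sums])
      have "summable (\<lambda>n. norm (fps_nth (F t) n * of_real l ^ n))"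
        using l by (intro norm_summable_fps less_le_trans[OF _ radius_F]) simp
      then have "summable (\<lambda>n. norm l ^ n / fact n * \<bar>LINT \<omega>|M. X t \<omega> ^ n\<bar>)"
        by (simp add: F_def norm_mult norm_divide norm_power mult.commute)
      from char_exp_sums_moments[OF int[OF t] this]
      have "(\<lambda>n. fps_nth (F t) n * z ^ n) sums (LINT \<omega>|M. exp (z * of_real (X t \<omega>)))"
        by (simp add: F_def z_def mult.commute)
      then show ?thesis
        unfolding \<Psi>[symmetric] using sums[OF z] by (rule sums_unique2)
    qed
    show "let c = \<lambda>n::nat. (\<i> * of_real l) ^ n / fact n *
               cinner (\<eta> (uea_of (star Y))) (((\<rho> (uea_of Y)) ^^ (n - 2)) (\<eta> (uea_of Y)));
         \<Psi> = \<i> * of_real l * L (uea_of Y) + suminf (\<lambda>n. c (n + 2))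
     in summable (\<lambda>n. c (n + 2)) \<and>
        (\<forall>t\<ge>0. (LINT \<omega>|M. exp (\<i> * of_real l * of_real (X t \<omega>))) = exp (of_real t * \<Psi>))"
      unfolding Let_def using c_summable char unfolding c_def z_def by (intro conjI allI impI)
  qed
qed

end
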